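(* As $n\to\infty$, $$\|p_n\|_\infty \sim \frac{2}{(2\pi)^n}\qquad\text{and}\qquad \|q_{2n}\|_\infty \sim \frac{4}{(2\pi)^{2n}}.$$
   Context: The Bernoulli polynomials $B_n(x)$ are defined by $B_0(x)=1$ and, for $n\ge1$, $\frac{d}{dx}B_n(x)=nB_{n-1}(x)$ together with $\int_0^1 B_n(x)\,dx=0$; the Bernoulli numbers are $B_n=B_n(0)$. Put $p_n(x)=B_n(x)/n!$ and $q_n(x)=B_n(x)/n!-B_n/n!$. For a polynomial $p$, $\|p\|_\infty=\max_{x\in[0,1]}|p(x)|$. Here $u_n\sim v_n$ means $u_n/v_n\to1$ as $n\to\infty$. *)

theory Defs
  imports
    "HOL-Analysis.Analysis"
    "HOL-Computational_Algebra.Polynomial"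
    "HOL-Library.Landau_Symbols"
begin

primrec bernoulli_poly :: "nat \<Rightarrow> real poly" where
  "bernoulli_poly 0 = 1"
| "bernoulli_poly (Suc n) =
     (THE p. pderiv p = smult (real (Suc n)) (bernoulli_poly n) \<and> integral {0..1} (poly p) = 0)"

lemma ex_pderiv_eq:
  fixes q :: "real poly"
  shows "\<exists>p. pderiv p = q"
proof -
  let ?p = "\<Sum>i\<le>degree q. monom (coeff q i / real (Suc i)) (Suc i)"
  have "pderiv ?p = (\<Sum>i\<le>degree q. monom (coeff q i) i)"
    unfolding sum_comp_morphism[of pderiv, OF pderiv_0 pderiv_add, symmetric] o_def
    by (intro sum.cong refl) (simp add: pderiv_monom del: of_nat_Suc)
  also have "\<dots> = q" by (rule poly_as_sum_of_monoms)
  finally show ?thesis by blast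
qed

lemma integral_poly_add_const:
  fixes p :: "real poly"
  shows "integral {0..1} (poly (p + [:c:])) = integral {0..1} (poly p) + c"
proof -
  have "integral {0..1} (poly (p + [:c:])) = integral {0..1} (\<lambda>x. poly p x + c)"
    by (rule integral_cong) simp
  also have "\<dots> = integral {0..1} (poly p) + integral {0..1} (\<lambda>x::real. c)"
    by (intro integral_add integrable_continuous_real continuous_intros)
  finally show ?thesis by simp
qed

text \<open>The description in \<^const>\<open>bernoulli_poly\<close> is proper: exactly one polynomial meets it.\<close>

lemma ex1_pderiv_eq_integral_0:
  fixes q :: "real poly"
  shows "\<exists>!p. pderiv p = q \<and> integral {0..1} (poly p) = 0"
proof -
  obtain p0 where p0: "pderiv p0 = q" using ex_pderiv_eq by blast
  show ?thesis
  proof (rule ex1I)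
    let ?p = "p0 + [:- integral {0..1} (poly p0):]"
    show "pderiv ?p = q \<and> integral {0..1} (poly ?p) = 0"
      using p0 by (simp only: integral_poly_add_const) (simp add: pderiv_add pderiv_pCons)
    fix p assume p: "pderiv p = q \<and> integral {0..1} (poly p) = 0"
    have "pderiv (p - p0) = 0" using p p0 by (simp add: pderiv_diff)
    then obtain c where "p - p0 = [:c:]"
      by (metis degree_eq_zeroE pderiv_eq_0_iff)
    hence pc: "p = p0 + [:c:]" by (metis add.commute diff_add_cancel)
    hence "integral {0..1} (poly p0) + c = 0"
      using p integral_poly_add_const by metis
    hence "c = - integral {0..1} (poly p0)" by simp
    thus "p = ?p" using pc by simp
  qed
qed

lemma
  shows pderiv_bernoulli_poly:
      "pderiv (bernoulli_poly (Suc n)) = smult (real (Suc n)) (bernoulli_poly n)"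
    and integral_bernoulli_poly: "integral {0..1} (poly (bernoulli_poly (Suc n))) = 0"
  using theI'[OF ex1_pderiv_eq_integral_0[of "smult (real (Suc n)) (bernoulli_poly n)"]]
  by simp_all

definition bernoulli_num :: "nat \<Rightarrow> real" where
  "bernoulli_num n = poly (bernoulli_poly n) 0"

definition p_poly :: "nat \<Rightarrow> real poly" where
  "p_poly n = smult (1 / fact n) (bernoulli_poly n)"

definition q_poly :: "nat \<Rightarrow> real poly" where
  "q_poly n = smult (1 / fact n) (bernoulli_poly n) - [:bernoulli_num n / fact n:]"

definition max_norm :: "real poly \<Rightarrow> real" where
  "max_norm p = (SUP x\<in>{0..1}. \<bar>poly p x\<bar>)"

text \<open>The supremum in \<^const>\<open>max_norm\<close> is a maximum (\<^const>\<open>Max\<close> is only for finite sets).\<close>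

lemma max_norm_attained: "\<exists>x\<in>{0..1}. max_norm p = \<bar>poly p x\<bar>"
  and max_norm_upper: "y \<in> {0..1} \<Longrightarrow> \<bar>poly p y\<bar> \<le> max_norm p"
proof -
  have "continuous_on {0..1} (\<lambda>x. \<bar>poly p x\<bar>)" by (intro continuous_intros)
  then obtain x where x: "x \<in> {0..1}" "\<And>y. y \<in> {0..1} \<Longrightarrow> \<bar>poly p y\<bar> \<le> \<bar>poly p x\<bar>"
    using continuous_attains_sup[OF compact_Icc, of 0 1 "\<lambda>x. \<bar>poly p x\<bar>"] by auto
  hence "max_norm p = \<bar>poly p x\<bar>"
    unfolding max_norm_def by (intro cSup_eq_maximum) auto
  thus "\<exists>x\<in>{0..1}. max_norm p = \<bar>poly p x\<bar>"
    and "y \<in> {0..1} \<Longrightarrow> \<bar>poly p y\<bar> \<le> max_norm p"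
    using x by auto
qed

end

theory Submission
  imports Defs
begin

text \<open>
  The leading Fourier mode of \<open>p\<^sub>n\<close> is \<open>- 2 cos (2\<pi>x - n\<pi>/2) / (2\<pi>)\<^sup>n\<close>. Let \<open>r\<^sub>n\<close> be \<open>p\<^sub>n\<close> with this
  mode removed. Then \<open>r\<^sub>n\<^sub>+\<^sub>1' = r\<^sub>n\<close>, each \<open>r\<^sub>n\<close> with \<open>n \<ge> 1\<close> is orthogonal to the frequencies 0 and 1, and
  \<open>r\<^sub>n\<^sub>+\<^sub>2(x) = - \<integral> k(\<bar>x - y\<bar>) r\<^sub>n(y) dy\<close> for a kernel \<open>k\<close> with
  \<open>\<integral> k\<^sup>2 = 1/720 - 2/(2\<pi>)\<^sup>4 < 1/(2\<pi>)\<^sup>4\<close>. Hence two integrations shrink the sup norm of \<open>r\<^sub>n\<close> by a factor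
  strictly smaller than \<open>1/(2\<pi>)\<^sup>2\<close>, so that \<open>r\<^sub>n\<close> is negligible against the leading mode. No convergence
  theorem for Fourier series is needed.
\<close>

section \<open>Antiderivatives and an upper bound for \<open>pi\<close>\<close>

lemma has_integral_derivative:
  fixes F f :: "real \<Rightarrow> real"
  assumes "a \<le> b" and "\<And>x. (F has_field_derivative f x) (at x)"
  shows "(f has_integral F b - F a) {a..b}"
  using assms
  by (intro fundamental_theorem_of_calculus)
     (auto simp flip: has_real_derivative_iff_has_vector_derivative
           intro: has_field_derivative_at_within)

text \<open>Otherwise \<open>17/30\<close> lies below \<open>pi/6\<close>, where the sine is
  \<open>1/2\<close>; but its Taylor polynomial with cubic error already gives
  \<open>sin (17/30) > 1/2\<close>.\<close>

lemma pi_less_17_5: "pi < 17/5"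
proof (rule ccontr)
  assume "\<not> pi < 17/5"
  hence "sin (17/30) \<le> sin (pi/6)" by (intro sin_monotone_2pi_le) auto
  hence "sin (17/30::real) \<le> 1/2" by (simp add: sin_30)
  moreover have "\<bar>sin (17/30) - 17/30\<bar> \<le> (17/30::real)^3 / 6"
    using Maclaurin_sin_bound[of "17/30" 3]
    by (simp add: numeral_3_eq_3 sin_coeff_def)
  ultimately show False by (simp add: power3_eq_cube abs_le_iff)
qed

section \<open>The kernel, its square integral and the contraction estimate\<close>

text \<open>
  The Green function \<open>B\<^sub>2(t)/2\<close> of the second derivative on the circle, with its own leading mode removed;
  the removal does not affect the representation of functions orthogonal to that mode, but without it the
  kernel would not contract.
\<close>

definition green :: "real \<Rightarrow> real" where
  "green t = (t\<^sup>2 - t) / 2 + 1/12 - cos (2 * pi * t) / (2 * pi\<^sup>2)"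

definition green_deriv :: "real \<Rightarrow> real" where
  "green_deriv t = t - 1/2 + sin (2 * pi * t) / pi"

lemma has_field_derivative_green:
  "(green has_field_derivative green_deriv t) (at t)"
  unfolding green_def[abs_def] green_deriv_def
  by (auto intro!: derivative_eq_intros simp: field_simps power2_eq_square)

lemma has_field_derivative_green_deriv:
  "(green_deriv has_field_derivative 1 + 2 * cos (2 * pi * t)) (at t)"
  unfolding green_deriv_def[abs_def]
  by (auto intro!: derivative_eq_intros simp: field_simps)

lemmas [derivative_intros] =
  DERIV_chain2[OF has_field_derivative_green]
  DERIV_chain2[OF has_field_derivative_green_deriv]

lemma green_reflect: "green (1 - t) = green t"
  by (simp add: green_def right_diff_distrib cos_diff power2_eq_square field_simps)

lemma green_deriv_reflect: "green_deriv (1 - t) = - green_deriv t"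
  by (simp add: green_deriv_def right_diff_distrib sin_diff)

text \<open>Squaring quadratic minus cosine leaves three terms to integrate: the squared quadratic,
  the mixed term (by parts) and the squared cosine. The value at 0 is not normalised to 0.\<close>

definition green_sq_primitive :: "real \<Rightarrow> real" where
  "green_sq_primitive t =
     t^5 / 20 - t^4 / 8 + t^3 / 9 - t\<^sup>2 / 24 + t / 144
     - (((t\<^sup>2 - t) / 2 + 1/12) * sin (2 * pi * t) / (2 * pi)
        + (t - 1/2) * cos (2 * pi * t) / (2 * pi)^2 - sin (2 * pi * t) / (2 * pi)^3) / pi\<^sup>2
     + (t / 2 + sin (2 * pi * t) * cos (2 * pi * t) / (4 * pi)) / (4 * pi^4)"

lemma has_field_derivative_green_sq_primitive:
  "(green_sq_primitive has_field_derivative (green t)\<^sup>2) (at t)"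
proof -
  define q where "q t = (t\<^sup>2 - t) / 2 + 1/12" for t :: real
  have q: "(q has_field_derivative t - 1/2) (at t)" for t
    unfolding q_def[abs_def] by (auto intro!: derivative_eq_intros simp: field_simps)
  have 1: "((\<lambda>t. t^5 / 20 - t^4 / 8 + t^3 / 9 - t\<^sup>2 / 24 + t / 144)
             has_field_derivative (q t)\<^sup>2) (at t)"
    unfolding q_def
    by (rule DERIV_cdivide[THEN DERIV_cong] derivative_eq_intros refl)+
       (simp add: field_simps eval_nat_numeral)
  have 2: "((\<lambda>t. q t * sin (2 * pi * t) / (2 * pi) + (t - 1/2) * cos (2 * pi * t) / (2 * pi)^2
                 - sin (2 * pi * t) / (2 * pi)^3) has_field_derivative q t * cos (2 * pi * t)) (at t)"
    by (rule DERIV_cdivide[THEN DERIV_cong] derivative_eq_intros refl q)+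
       (simp add: field_simps eval_nat_numeral)
  have 3: "((\<lambda>t. t / 2 + sin (2 * pi * t) * cos (2 * pi * t) / (4 * pi))
             has_field_derivative (cos (2 * pi * t))\<^sup>2) (at t)"
  proof -
    have "((\<lambda>t. t / 2 + sin (2 * pi * t) * cos (2 * pi * t) / (4 * pi)) has_field_derivative
            1/2 + ((cos (2 * pi * t))\<^sup>2 - (sin (2 * pi * t))\<^sup>2) / 2) (at t)"
      by (rule DERIV_cdivide[THEN DERIV_cong] derivative_eq_intros refl)+
         (simp add: field_simps power2_eq_square)
    thus ?thesis by (simp add: sin_squared_eq diff_divide_distrib)
  qed
  have "(green_sq_primitive has_field_derivative
          (q t)\<^sup>2 - q t * cos (2 * pi * t) / pi\<^sup>2 + (cos (2 * pi * t))\<^sup>2 / (4 * pi^4)) (at t)"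
    unfolding green_sq_primitive_def[abs_def] q_def[symmetric]
    by (intro DERIV_add DERIV_diff DERIV_cdivide 1 2 3)
  moreover have "(green t)\<^sup>2 =
      (q t)\<^sup>2 - q t * cos (2 * pi * t) / pi\<^sup>2 + (cos (2 * pi * t))\<^sup>2 / (4 * pi^4)"
    unfolding green_def q_def[symmetric]
    by (simp add: power2_diff power_divide power_mult_distrib flip: power_mult)
  ultimately show ?thesis by simp
qed

text \<open>By the symmetry of the kernel, the pieces of lengths \<open>x\<close> and
  \<open>1 - x\<close> together make up one full period, so \<open>x\<close> drops out. In
  Parseval's terms, \<open>1/720\<close> belongs to all frequencies and
  \<open>2 / (2 * pi)^4\<close> to the removed one.\<close>

lemma green_sq_primitive_reflect:
  "green_sq_primitive x + green_sq_primitive (1 - x) - 2 * green_sq_primitive 0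
     = 1/720 - 2 / (2 * pi)^4"
proof -
  have trig: "sin (2 * pi * (1 - x)) = - sin (2 * pi * x)"
             "cos (2 * pi * (1 - x)) = cos (2 * pi * x)"
    by (simp_all add: right_diff_distrib sin_diff cos_diff)
  have q: "(1 - x)\<^sup>2 - (1 - x) = x\<^sup>2 - x"
    by (simp add: power2_eq_square algebra_simps)
  have "(x^5 / 20 - x^4 / 8 + x^3 / 9 - x\<^sup>2 / 24 + x / 144) +
        ((1 - x)^5 / 20 - (1 - x)^4 / 8 + (1 - x)^3 / 9 - (1 - x)\<^sup>2 / 24 + (1 - x) / 144)
        = (1/720 :: real)"
    by (simp add: field_simps eval_nat_numeral)
  moreover have "green_sq_primitive 0 = 1 / (8 * pi^4)"
    by (simp add: green_sq_primitive_def field_simps eval_nat_numeral)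
  ultimately show ?thesis
    unfolding green_sq_primitive_def[of x] green_sq_primitive_def[of "1 - x"] trig q
    by (simp add: power_mult_distrib add_divide_distrib diff_divide_distrib algebra_simps)
qed

lemmas [derivative_intros] = DERIV_chain2[OF has_field_derivative_green_sq_primitive]

lemma has_integral_green_kernel_sq:
  assumes "0 \<le> x" "x \<le> 1"
  shows "((\<lambda>y. (green \<bar>x - y\<bar>)\<^sup>2) has_integral 1/720 - 2 / (2 * pi)^4) {0..1}"
proof -
  have "((\<lambda>y. - green_sq_primitive (x - y)) has_field_derivative (green (x - y))\<^sup>2) (at y)" for y
    by (rule derivative_eq_intros refl)+ simp
  from has_integral_derivative[OF assms(1) this]
  have 1: "((\<lambda>y. (green \<bar>x - y\<bar>)\<^sup>2) has_integral
           green_sq_primitive x - green_sq_primitive 0) {0..x}"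
    by (subst has_integral_cong[where g = "\<lambda>y. (green (x - y))\<^sup>2"]) auto
  have "((\<lambda>y. green_sq_primitive (y - x)) has_field_derivative (green (y - x))\<^sup>2) (at y)" for y
    by (rule derivative_eq_intros refl)+ simp
  from has_integral_derivative[OF assms(2) this]
  have 2: "((\<lambda>y. (green \<bar>x - y\<bar>)\<^sup>2) has_integral
           green_sq_primitive (1 - x) - green_sq_primitive 0) {x..1}"
    by (subst has_integral_cong[where g = "\<lambda>y. (green (y - x))\<^sup>2"]) auto
  have "green_sq_primitive x - green_sq_primitive 0
          + (green_sq_primitive (1 - x) - green_sq_primitive 0) = 1/720 - 2 / (2 * pi)^4"
    using green_sq_primitive_reflect[of x] by linarith
  with has_integral_combine[OF assms 1 2] show ?thesis by simp
qed

text \<open>Two integrations by parts on either side of \<open>y = x\<close>. Away from the diagonal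
  the second derivative of the kernel is \<open>1 + 2 * cos\<close>, and \<open>mean\<close> and
  \<open>orth\<close> annihilate its product with \<open>f\<close>.\<close>

lemma green_representation:
  fixes f f' f'' :: "real \<Rightarrow> real"
  assumes f': "\<And>y. (f has_field_derivative f' y) (at y)"
    and f'': "\<And>y. (f' has_field_derivative f'' y) (at y)"
    and per: "f 1 = f 0" "f' 1 = f' 0"
    and mean: "(f has_integral 0) {0..1}"
    and orth: "((\<lambda>y. f y * cos (2 * pi * y - 2 * pi * x)) has_integral 0) {0..1}"
    and x: "0 \<le> x" "x \<le> 1"
  shows "((\<lambda>y. green \<bar>x - y\<bar> * f'' y) has_integral - f x) {0..1}"
proof -
  define m where "m y = f y * (1 + 2 * cos (2 * pi * y - 2 * pi * x))" for y
  have m: "(m has_integral 0) {0..1}"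
    using has_integral_add[OF mean has_integral_mult_right[OF orth, of 2]]
    by (simp add: m_def[abs_def] algebra_simps)
  define G where "G y = green (x - y) * f' y + green_deriv (x - y) * f y" for y
  define H where "H y = green (y - x) * f' y - green_deriv (y - x) * f y" for y
  have ceq: "cos (2 * pi * (x - y)) = cos (2 * pi * y - 2 * pi * x)"
            "cos (2 * pi * (y - x)) = cos (2 * pi * y - 2 * pi * x)" for y
    by (simp_all add: right_diff_distrib cos_diff)
  have "(G has_field_derivative green (x - y) * f'' y - m y) (at y)" for y
    unfolding G_def[abs_def] m_def
    by (rule derivative_eq_intros refl f' f'')+ (simp only: ceq, simp add: algebra_simps)
  from has_integral_derivative[OF x(1) this]
  have 1: "((\<lambda>y. green \<bar>x - y\<bar> * f'' y - m y) has_integral G x - G 0) {0..x}"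
    by (subst has_integral_cong[where g = "\<lambda>y. green (x - y) * f'' y - m y"]) auto
  have "(H has_field_derivative green (y - x) * f'' y - m y) (at y)" for y
    unfolding H_def[abs_def] m_def
    by (rule derivative_eq_intros refl f' f'')+ (simp only: ceq, simp add: algebra_simps)
  from has_integral_derivative[OF x(2) this]
  have 2: "((\<lambda>y. green \<bar>x - y\<bar> * f'' y - m y) has_integral H 1 - H x) {x..1}"
    by (subst has_integral_cong[where g = "\<lambda>y. green (y - x) * f'' y - m y"]) auto
  \<comment> \<open>Periodicity and reflection cancel the terms at 0 and 1. At \<open>y = x\<close>
    both sides contribute \<open>green_deriv 0 = -1/2\<close>, which leaves
    \<open>- f x\<close>.\<close>
  have "G x - G 0 + (H 1 - H x) = - f x"
    by (simp add: G_def H_def per green_reflect green_deriv_reflect)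
       (simp add: green_deriv_def)
  with has_integral_add[OF has_integral_combine[OF x 1 2] m] show ?thesis by simp
qed

text \<open>
  With \<open>\<pi> < 17/5\<close> the kernel estimate gives the factor 0.985 in front of \<open>1/(2\<pi>)\<^sup>2\<close>, which is below
  \<open>(199/200)\<^sup>2\<close>; a square is convenient because each step advances the index by 2.
\<close>

lemma green_contraction:
  fixes f f' f'' :: "real \<Rightarrow> real"
  assumes f': "\<And>y. (f has_field_derivative f' y) (at y)"
    and f'': "\<And>y. (f' has_field_derivative f'' y) (at y)"
    and per: "f 1 = f 0" "f' 1 = f' 0"
    and mean: "(f has_integral 0) {0..1}"
    and orth: "\<And>a. ((\<lambda>y. f y * cos (2 * pi * y - a)) has_integral 0) {0..1}"
    and M: "\<And>y. y \<in> {0..1} \<Longrightarrow> \<bar>f'' y\<bar> \<le> M"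
    and x: "0 \<le> x" "x \<le> 1"
  shows "\<bar>f x\<bar> \<le> M * ((199/200) / (2 * pi))\<^sup>2"
proof -
  let ?S = "1/720 - 2 / (2 * pi)^4 :: real"
  let ?w = "(2 * pi)\<^sup>2"
  \<comment> \<open>A pointwise substitute for Cauchy-Schwarz: for \<open>M > 0\<close> the integral
    of this majorant is below \<open>M / ?w\<close> precisely when
    \<open>?S < 1 / ?w\<^sup>2\<close>.\<close>
  let ?g = "\<lambda>y. M * (?w / 2 * (green \<bar>x - y\<bar>)\<^sup>2 + 1 / (2 * ?w))"
  have w: "?w > 0" by simp
  have rep: "((\<lambda>y. green \<bar>x - y\<bar> * f'' y) has_integral - f x) {0..1}"
    using assms by (intro green_representation)
  have g: "(?g has_integral M * (?w / 2 * ?S + 1 / (2 * ?w))) {0..1}"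
    using has_integral_const_real[of "1 / (2 * ?w)" 0 1]
    by (intro has_integral_mult_right has_integral_add has_integral_green_kernel_sq x) simp_all
  have le: "\<bar>green \<bar>x - y\<bar> * f'' y\<bar> \<le> ?g y" if "y \<in> {0..1}" for y
  proof -
    let ?k = "green \<bar>x - y\<bar>"
    \<comment> \<open>AM-GM: \<open>2 \<bar>k\<bar> \<le> w k\<^sup>2 + 1/w\<close>\<close>
    have "0 \<le> (?w * \<bar>?k\<bar> - 1)\<^sup>2 / (2 * ?w)" by simp
    also have "\<dots> = ?w / 2 * ?k\<^sup>2 + 1 / (2 * ?w) - \<bar>?k\<bar>"
      using w by (simp add: power2_diff power_mult_distrib field_simps power2_eq_square[of ?w])
    finally have "\<bar>?k\<bar> \<le> ?w / 2 * ?k\<^sup>2 + 1 / (2 * ?w)" by simp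
    moreover have "\<bar>f'' y\<bar> \<le> M" using M that by blast
    ultimately have "\<bar>f'' y\<bar> * \<bar>?k\<bar> \<le> ?g y" by (intro mult_mono) auto
    thus ?thesis by (simp add: abs_mult mult.commute)
  qed
  have "- f x \<le> M * (?w / 2 * ?S + 1 / (2 * ?w))"
    using rep g by (rule has_integral_le) (use le in fastforce)
  moreover have "f x \<le> M * (?w / 2 * ?S + 1 / (2 * ?w))"
    using has_integral_neg[OF rep] g
    by (simp only: minus_minus) (rule has_integral_le, assumption, assumption, use le in fastforce)
  ultimately have "\<bar>f x\<bar> \<le> M * (?w / 2 * ?S + 1 / (2 * ?w))" by linarith
  also have "\<dots> \<le> M * ((199/200) / (2 * pi))\<^sup>2"
  proof (rule mult_left_mono)
    have "(2 * pi)^4 \<le> (34/5)^4" using pi_less_17_5 by (intro power_mono) auto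
    hence "(2 * pi)^4 / 720 - 1 \<le> 2 * (199/200)\<^sup>2" by (simp add: eval_nat_numeral)
    hence "((2 * pi)^4 / 720 - 1) / (2 * ?w) \<le> 2 * (199/200)\<^sup>2 / (2 * ?w)"
      by (intro divide_right_mono) auto
    moreover have "?w / 2 * ?S + 1 / (2 * ?w) = ((2 * pi)^4 / 720 - 1) / (2 * ?w)"
    proof -
      have "u / 2 * (1/720 - 2 / (u * u)) + 1 / (2 * u) = (u * u / 720 - 1) / (2 * u)"
        if "u > 0" for u :: real
        using that by (simp add: field_simps)
      moreover have "(2 * pi)^4 = ?w * ?w" by (simp add: eval_nat_numeral)
      ultimately show ?thesis using w by (simp only:)
    qed
    ultimately show "?w / 2 * ?S + 1 / (2 * ?w) \<le> ((199/200) / (2 * pi))\<^sup>2"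
      by (simp only: power_divide) simp
    show "0 \<le> M" using M[of 0] by (auto intro: order_trans[OF abs_ge_zero])
  qed
  finally show ?thesis .
qed

section \<open>The scaled Bernoulli polynomials and their remainders\<close>

lemma pderiv_p_poly: "pderiv (p_poly (Suc n)) = p_poly n"
  by (simp add: p_poly_def pderiv_smult pderiv_bernoulli_poly del: bernoulli_poly.simps of_nat_Suc)

lemma integral_p_poly: "(poly (p_poly (Suc n)) has_integral 0) {0..1}"
proof -
  have "poly (bernoulli_poly (Suc n)) integrable_on {0..1}"
    by (intro integrable_continuous_real continuous_intros)
  hence "(poly (bernoulli_poly (Suc n)) has_integral 0) {0..1}"
    using integrable_integral integral_bernoulli_poly[of n] by fastforce
  from has_integral_mult_right[OF this, of "1 / fact (Suc n)"] show ?thesis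
    by (simp add: p_poly_def poly_smult[abs_def] del: bernoulli_poly.simps)
qed

text \<open>Identified through uniqueness, by its derivative and mean; this explicit form starts the
  orthogonality induction.\<close>

lemma p_poly_1: "p_poly 1 = [:-1/2, 1:]"
proof -
  have "((\<lambda>x. x - 1/2) has_integral (1\<^sup>2/2 - 1/2) - (0\<^sup>2/2 - 0/2)) {0..1::real}"
    by (rule has_integral_derivative[where F = "\<lambda>x. x\<^sup>2/2 - x/2"])
       (auto intro!: derivative_eq_intros)
  moreover have "poly [:-1/2, 1::real:] = (\<lambda>x. x - 1/2)" by auto
  ultimately have "integral {0..1} (poly [:-1/2, 1::real:]) = 0"
    by (simp add: integral_unique)
  moreover have "pderiv [:-1/2, 1::real:] = 1" by (simp add: pderiv_pCons)
  moreover have "pderiv (p_poly 1) = 1" "integral {0..1} (poly (p_poly 1)) = 0"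
    using pderiv_p_poly[of 0] integral_unique[OF integral_p_poly[of 0]]
    by (simp_all add: p_poly_def del: bernoulli_poly.simps(2))
  ultimately show ?thesis
    using ex1_pderiv_eq_integral_0[of 1] by blast
qed

definition p_rem :: "nat \<Rightarrow> real \<Rightarrow> real" where
  "p_rem n x = poly (p_poly n) x + 2 * cos (2 * pi * x - real n * pi / 2) / (2 * pi)^n"

lemma has_field_derivative_p_rem:
  "(p_rem (Suc n) has_field_derivative p_rem n x) (at x)"
proof -
  have "cos (2 * pi * x - real n * pi / 2) = - sin (2 * pi * x - real (Suc n) * pi / 2)"
    by (simp add: algebra_simps add_divide_distrib sin_diff cos_diff sin_add cos_add)
  thus ?thesis
    unfolding p_rem_def[abs_def]
    by (auto intro!: derivative_eq_intros poly_DERIV simp: pderiv_p_poly simp del: of_nat_Suc)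
qed

lemma has_integral_p_rem: "(p_rem (Suc n) has_integral 0) {0..1}"
proof -
  let ?c = "\<lambda>x. 2 * cos (2 * pi * x - real (Suc n) * pi / 2) / (2 * pi)^Suc n"
  let ?s = "\<lambda>x. 2 * sin (2 * pi * x - real (Suc n) * pi / 2) / (2 * pi)^Suc (Suc n)"
  have "(?c has_integral ?s 1 - ?s 0) {0..1}"
    by (rule has_integral_derivative)
       (auto intro!: derivative_eq_intros simp del: of_nat_Suc)
  moreover have "?s 1 = ?s 0" by (simp add: sin_diff)
  ultimately have "(?c has_integral 0) {0..1}" by simp
  from has_integral_add[OF integral_p_poly[of n] this] show ?thesis
    by (simp only: p_rem_def[abs_def] add_0)
qed

text \<open>The endpoint difference is the integral of the preceding remainder. The index starts at
  2 because \<open>p_rem 1\<close> is a sawtooth with a jump.\<close>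

lemma p_rem_periodic: "p_rem (Suc (Suc n)) 1 = p_rem (Suc (Suc n)) 0"
proof -
  have "(p_rem (Suc n) has_integral p_rem (Suc (Suc n)) 1 - p_rem (Suc (Suc n)) 0) {0..1}"
    by (intro has_integral_derivative has_field_derivative_p_rem) simp
  from has_integral_unique[OF this has_integral_p_rem] show ?thesis by simp
qed

text \<open>Integration by parts lowers the index and turns the cosine into a sine; with an
  arbitrary phase \<open>a\<close> the sine is again a cosine, with phase \<open>a + pi/2\<close>,
  so the induction closes.\<close>

lemma p_rem_orthogonal:
  "((\<lambda>y. p_rem (Suc n) y * cos (2 * pi * y - a)) has_integral 0) {0..1}"
proof (induction n arbitrary: a)
  case 0
  let ?F = "\<lambda>y. (y - 1/2) * sin (2 * pi * y - a) / (2 * pi) + cos (2 * pi * y - a) / (2 * pi)\<^sup>2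
                 + y * sin a / (2 * pi) - cos (4 * pi * y - a) / (8 * pi\<^sup>2)"
  have "((\<lambda>y. (y - 1/2) * cos (2 * pi * y - a) + (sin a + sin (4 * pi * y - a)) / (2 * pi))
          has_integral ?F 1 - ?F 0) {0..1}"
    by (rule has_integral_derivative)
       (rule derivative_eq_intros refl | simp add: field_simps power2_eq_square)+
  \<comment> \<open>The jump of the sawtooth contributes \<open>- sin a / (2 * pi)\<close>, and the
    removed mode contributes the opposite amount.\<close>
  moreover have "?F 1 - ?F 0 = 0"
    using cos_npi[of 4] sin_npi[of 4] by (simp add: sin_diff cos_diff field_simps)
  moreover have "(y - 1/2) * cos (2 * pi * y - a) + (sin a + sin (4 * pi * y - a)) / (2 * pi)
                   = p_rem (Suc 0) y * cos (2 * pi * y - a)" for y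
  proof -
    have "sin a + sin (4 * pi * y - a) = 2 * sin (2 * pi * y) * cos (2 * pi * y - a)"
      using sin_plus_sin[of "4 * pi * y - a" a] by (simp add: field_simps diff_divide_distrib)
    moreover have "p_rem (Suc 0) y = y - 1/2 + sin (2 * pi * y) / pi"
      by (simp add: p_rem_def p_poly_1[unfolded One_nat_def] cos_diff)
    ultimately show ?thesis by (simp only:) (simp add: field_simps)
  qed
  ultimately show ?case by simp
next
  case (Suc n)
  let ?F = "\<lambda>y. p_rem (Suc (Suc n)) y * sin (2 * pi * y - a) / (2 * pi)"
  have 1: "((\<lambda>y. p_rem (Suc (Suc n)) y * cos (2 * pi * y - a)
              + p_rem (Suc n) y * sin (2 * pi * y - a) / (2 * pi)) has_integral ?F 1 - ?F 0) {0..1}"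
    by (rule has_integral_derivative)
       (auto intro!: derivative_eq_intros has_field_derivative_p_rem simp: field_simps)
  have 2: "?F 1 - ?F 0 = 0" by (simp add: p_rem_periodic sin_diff)
  have 3: "((\<lambda>y. p_rem (Suc n) y * sin (2 * pi * y - a) / (2 * pi)) has_integral 0) {0..1}"
  proof -
    have "sin (2 * pi * y - a) = cos (2 * pi * y - (a + pi/2))" for y
      by (simp add: sin_diff cos_diff cos_add sin_add)
    with has_integral_divide[OF Suc.IH[of "a + pi/2"], of "2 * pi"] show ?thesis by simp
  qed
  from has_integral_diff[OF 1[unfolded 2] 3] show ?case by simp
qed

text \<open>The derivative must be periodic as well, so it needs index at least 2; hence the first
  remainder covered has index 3.\<close>

lemma p_rem_contraction:
  assumes "\<And>y. y \<in> {0..1} \<Longrightarrow> \<bar>p_rem (Suc n) y\<bar> \<le> M" and "x \<in> {0..1}"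
  shows "\<bar>p_rem (Suc (Suc (Suc n))) x\<bar> \<le> M * ((199/200) / (2 * pi))\<^sup>2"
  using assms
  by (intro green_contraction[where f' = "p_rem (Suc (Suc n))" and f'' = "p_rem (Suc n)"]
        has_field_derivative_p_rem p_rem_periodic has_integral_p_rem p_rem_orthogonal) auto

lemma p_rem_bound:
  obtains C where "\<And>n x. x \<in> {0..1} \<Longrightarrow> \<bar>p_rem (Suc n) x\<bar> \<le> C * ((199/200) / (2 * pi))^Suc n"
proof -
  define q where "q = (199/200) / (2 * pi)"
  have q: "q > 0" by (simp add: q_def)
  have "\<exists>B. \<forall>x\<in>{0..1}. \<bar>p_rem n x\<bar> \<le> B" for n
  proof -
    have "continuous_on {0..1} (p_rem n)"
      unfolding p_rem_def by (intro continuous_intros) auto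
    hence "bounded (p_rem n ` {0..1})"
      by (intro compact_imp_bounded compact_continuous_image) auto
    thus ?thesis by (auto simp: bounded_iff)
  qed
  then obtain B where B: "\<And>n x. x \<in> {0..1} \<Longrightarrow> \<bar>p_rem n x\<bar> \<le> B n" by metis
  \<comment> \<open>The induction advances by 2, so indices 1 and 2 are both base cases, and
    \<open>C\<close> must dominate each.\<close>
  define C where "C = max (B 1 / q) (B 2 / q\<^sup>2)"
  have "\<bar>p_rem (Suc n) x\<bar> \<le> C * q^Suc n" if "x \<in> {0..1}" for n x
    using that
  proof (induction n arbitrary: x rule: induct_nat_012)
    case 0
    have "B 1 / q \<le> C" by (simp add: C_def)
    hence "B 1 \<le> C * q" using q by (simp only: pos_divide_le_eq)
    with B[OF 0, of 1] show ?case by simp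
  next
    case 1
    have "B 2 / q\<^sup>2 \<le> C" by (simp add: C_def)
    moreover have "q\<^sup>2 > 0" using q by simp
    ultimately have "B 2 \<le> C * q\<^sup>2" by (simp only: pos_divide_le_eq)
    with B[OF 1, of 2] show ?case by (simp add: numeral_2_eq_2)
  next
    case (ge2 n)
    from p_rem_contraction[OF ge2.IH(1) ge2.prems, folded q_def] show ?case
      by (simp add: power2_eq_square mult_ac)
  qed
  with that show ?thesis by (auto simp: q_def)
qed

section \<open>Sup norms and asymptotics\<close>

lemma max_norm_le:
  assumes "\<And>x. x \<in> {0..1} \<Longrightarrow> \<bar>poly p x\<bar> \<le> B"
  shows "max_norm p \<le> B"
  using max_norm_attained[of p] assms by auto

text \<open>The leading mode attains its amplitude \<open>2 / (2 * pi)^n\<close> on the unit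
  interval, and the remainder moves the norm by at most \<open>e\<close>.\<close>

lemma max_norm_p_poly_diff:
  assumes "\<And>x. x \<in> {0..1} \<Longrightarrow> \<bar>p_rem n x\<bar> \<le> e"
  shows "\<bar>max_norm (p_poly n) - 2 / (2 * pi)^n\<bar> \<le> e"
proof -
  let ?c = "\<lambda>x. cos (2 * pi * x - real n * pi / 2)"
  have "max_norm (p_poly n) \<le> 2 / (2 * pi)^n + e"
  proof (rule max_norm_le)
    fix x :: real assume x: "x \<in> {0..1}"
    have "\<bar>2 * ?c x / (2 * pi)^n\<bar> \<le> 2 / (2 * pi)^n"
      by (simp add: abs_mult divide_right_mono)
    with assms[OF x] show "\<bar>poly (p_poly n) x\<bar> \<le> 2 / (2 * pi)^n + e"
      unfolding p_rem_def by linarith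
  qed
  moreover have "2 / (2 * pi)^n - e \<le> max_norm (p_poly n)"
  proof -
    \<comment> \<open>the phase of the cosine is a multiple of \<open>2\<pi>\<close> at this point\<close>
    define x where "x = frac (real n / 4)"
    have x: "x \<in> {0..1}" using frac_lt_1[of "real n / 4"] by (simp add: x_def)
    have "2 * pi * x - real n * pi / 2 = 2 * pi * of_int (- \<lfloor>real n / 4\<rfloor>)"
      by (simp add: x_def frac_def field_simps)
    hence "?c x = 1" by (metis cos_int_2pin)
    hence "2 / (2 * pi)^n - e \<le> \<bar>poly (p_poly n) x\<bar>"
      using assms[OF x] unfolding p_rem_def by simp
    with max_norm_upper[OF x, of "p_poly n"] show ?thesis by linarith
  qed
  ultimately show ?thesis by linarith
qed

text \<open>In even degree, subtracting the value at 0 turns the mode into a signed multiple of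
  \<open>1 - cos (2 * pi * x)\<close>, which is largest at \<open>1/2\<close>. The remainder enters
  at \<open>x\<close> and at 0, hence \<open>2 * e\<close>.\<close>

lemma max_norm_q_poly_diff:
  assumes e: "\<And>x. x \<in> {0..1} \<Longrightarrow> \<bar>p_rem (2 * n) x\<bar> \<le> e"
  shows "\<bar>max_norm (q_poly (2 * n)) - 4 / (2 * pi)^(2 * n)\<bar> \<le> 2 * e"
proof -
  let ?d = "(2 * pi)^(2 * n)"
  have q: "poly (q_poly (2 * n)) x =
      p_rem (2 * n) x - p_rem (2 * n) 0 + (- 1)^n * (2 * (1 - cos (2 * pi * x)) / ?d)" for x
    by (simp add: q_poly_def p_rem_def p_poly_def bernoulli_num_def cos_diff cos_npi sin_npi
        mult.commute[of _ pi] field_simps)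
  have e0: "\<bar>p_rem (2 * n) 0\<bar> \<le> e" using e[of 0] by simp
  have "max_norm (q_poly (2 * n)) \<le> 4 / ?d + 2 * e"
  proof (rule max_norm_le)
    fix x :: real assume x: "x \<in> {0..1}"
    have "\<bar>2 * (1 - c)\<bar> \<le> 4" if "\<bar>c\<bar> \<le> 1" for c :: real
      using that by (simp add: abs_le_iff)
    hence "\<bar>2 * (1 - cos (2 * pi * x))\<bar> \<le> 4" using abs_cos_le_one by blast
    hence "\<bar>2 * (1 - cos (2 * pi * x))\<bar> / ?d \<le> 4 / ?d"
      by (rule divide_right_mono) simp
    hence "\<bar>(- 1)^n * (2 * (1 - cos (2 * pi * x)) / ?d)\<bar> \<le> 4 / ?d"
      by (simp only: abs_mult abs_divide power_abs) simp
    with e[OF x] e0 show "\<bar>poly (q_poly (2 * n)) x\<bar> \<le> 4 / ?d + 2 * e"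
      unfolding q by linarith
  qed
  moreover have "4 / ?d - 2 * e \<le> max_norm (q_poly (2 * n))"
  proof -
    have h: "(1/2::real) \<in> {0..1}" by simp
    have "\<bar>(- 1)^n * (2 * (1 - cos (2 * pi * (1/2))) / ?d)\<bar> = 4 / ?d"
      by (simp add: abs_mult power_abs)
    hence "4 / ?d - 2 * e \<le> \<bar>poly (q_poly (2 * n)) (1/2)\<bar>"
      using e[OF h] e0 unfolding q by linarith
    with max_norm_upper[OF h, of "q_poly (2 * n)"] show ?thesis by linarith
  qed
  ultimately show ?thesis by linarith
qed

text \<open>The relative error is at most \<open>C / c * r^n\<close>. Index 0 is excluded because
  the remainder bound starts at index 1.\<close>

lemma asymp_equiv_of_geometric_error:
  fixes u :: "nat \<Rightarrow> real"
  assumes err: "\<And>n. n > 0 \<Longrightarrow> \<bar>u n - c / b^n\<bar> \<le> C * (r / b)^n"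
    and "b > 0" "c > 0" "0 \<le> r" "r < 1"
  shows "u \<sim>[at_top] (\<lambda>n. c / b^n)"
proof (rule asymp_equivI')
  have "(\<lambda>n. u n / (c / b^n) - 1) \<longlonglongrightarrow> 0"
  proof (rule Lim_null_comparison)
    show "\<forall>\<^sub>F n in sequentially. norm (u n / (c / b^n) - 1) \<le> C / c * r^n"
      using eventually_gt_at_top[of 0]
    proof eventually_elim
      case (elim n)
      have "u n / (c / b^n) - 1 = (u n - c / b^n) * (b^n / c)"
        using assms by (simp add: field_simps)
      hence "norm (u n / (c / b^n) - 1) = \<bar>u n - c / b^n\<bar> * (b^n / c)"
        using assms by (simp add: abs_mult)
      also have "\<dots> \<le> C * (r / b)^n * (b^n / c)"
        using assms elim by (intro mult_right_mono err) auto
      also have "\<dots> = C / c * r^n" using assms by (simp add: power_divide)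
      finally show ?case .
    qed
    show "(\<lambda>n. C / c * r^n) \<longlonglongrightarrow> 0"
      using assms by (intro tendsto_mult_right_zero LIMSEQ_power_zero) auto
  qed
  thus "(\<lambda>n. u n / (c / b^n)) \<longlonglongrightarrow> 1" using LIM_zero_iff by blast
qed

theorem mainTheorem8:
  shows "(\<lambda>n. max_norm (p_poly n)) \<sim>[at_top] (\<lambda>n. 2 / (2 * pi) ^ n) \<and>
         (\<lambda>n. max_norm (q_poly (2 * n))) \<sim>[at_top] (\<lambda>n. 4 / (2 * pi) ^ (2 * n))"
proof -
  obtain C where "\<And>n x. x \<in> {0..1} \<Longrightarrow> \<bar>p_rem (Suc n) x\<bar> \<le> C * ((199/200) / (2 * pi))^Suc n"
    using p_rem_bound by blast
  hence C: "\<bar>p_rem n x\<bar> \<le> C * ((199/200) / (2 * pi))^n" if "n > 0" "x \<in> {0..1}" for n x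
    using that by (cases n) auto
  have "(\<lambda>n. max_norm (p_poly n)) \<sim>[at_top] (\<lambda>n. 2 / (2 * pi)^n)"
    using max_norm_p_poly_diff[OF C]
    by (rule asymp_equiv_of_geometric_error) simp_all
  \<comment> \<open>Even indices form a geometric scale with base \<open>(2 * pi)\<^sup>2\<close>,
    so the ratio is squared too.\<close>
  moreover have "(\<lambda>n. max_norm (q_poly (2 * n))) \<sim>[at_top] (\<lambda>n. 4 / ((2 * pi)\<^sup>2)^n)"
  proof (rule asymp_equiv_of_geometric_error[where r = "(199/200)\<^sup>2" and C = "2 * C"])
    fix n :: nat assume "n > 0"
    hence "\<bar>max_norm (q_poly (2 * n)) - 4 / (2 * pi)^(2 * n)\<bar>
             \<le> 2 * (C * ((199/200) / (2 * pi))^(2 * n))"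
      by (intro max_norm_q_poly_diff C) auto
    thus "\<bar>max_norm (q_poly (2 * n)) - 4 / ((2 * pi)\<^sup>2)^n\<bar>
             \<le> 2 * C * ((199/200)\<^sup>2 / (2 * pi)\<^sup>2)^n"
      by (simp only: power_mult power_divide mult.assoc)
  qed (auto simp: power2_eq_square)
  ultimately show ?thesis by (simp only: power_mult)
qed

end
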